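(* Let $(W,S)$ be a Coxeter system with $S$ finite. For each cone type $T$ of $W$ there is a unique element $m_T\in W$ of minimal length such that $T(m_T)=T$. Moreover, if $w\in W$ with $T(w)=T$ then $m_T$ is a suffix of $w$.
   Context: $\ell:W\to\mathbb{N}$ is the length function of $(W,S)$. The cone type of $x\in W$ is $T(x)=\{y\in W\mid \ell(xy)=\ell(x)+\ell(y)\}$. A cone type of $W$ is a set of the form $T(x)$ for some $x\in W$. An element $u\in W$ is a suffix of $w\in W$ if $\ell(w)=\ell(wu^{-1})+\ell(u)$. *)

theory Defs
  imports "HOL-Algebra.Generated_Groups" "HOL-Library.Extended_Nat"
begin

text \<open>Words in the letters \<open>S\<close> and their formal inverses: \<open>(s, True)\<close> stands for \<open>s\<close> and
  \<open>(s, False)\<close> for the inverse of \<open>s\<close>.\<close>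

type_synonym 'a gword = "('a \<times> bool) list"

fun gword_eval :: "('a, 'b) monoid_scheme \<Rightarrow> 'a gword \<Rightarrow> 'a" where
  "gword_eval G [] = \<one>\<^bsub>G\<^esub>"
| "gword_eval G ((s, e) # w) = (if e then s else inv\<^bsub>G\<^esub> s) \<otimes>\<^bsub>G\<^esub> gword_eval G w"

text \<open>Equality in the group presented by generators \<open>S\<close> and relators \<open>R\<close>: the congruence
  on words generated by free cancellation and by deletion of relators.\<close>

inductive pres_eq :: "'a set \<Rightarrow> 'a gword set \<Rightarrow> 'a gword \<Rightarrow> 'a gword \<Rightarrow> bool"
  for S :: "'a set" and R :: "'a gword set" where
  refl: "w \<in> lists (S \<times> UNIV) \<Longrightarrow> pres_eq S R w w"
| sym: "pres_eq S R v w \<Longrightarrow> pres_eq S R w v"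
| trans: "pres_eq S R u v \<Longrightarrow> pres_eq S R v w \<Longrightarrow> pres_eq S R u w"
| cancel: "s \<in> S \<Longrightarrow> u \<in> lists (S \<times> UNIV) \<Longrightarrow> v \<in> lists (S \<times> UNIV) \<Longrightarrow>
    pres_eq S R (u @ [(s, e), (s, \<not> e)] @ v) (u @ v)"
| relator: "r \<in> R \<Longrightarrow> u \<in> lists (S \<times> UNIV) \<Longrightarrow> v \<in> lists (S \<times> UNIV) \<Longrightarrow>
    pres_eq S R (u @ r @ v) (u @ v)"

text \<open>\<open>G\<close> is the group with presentation \<open>\<langle>S | R\<rangle>\<close>: evaluation of words maps onto \<open>G\<close>, and the
  words with trivial value are exactly those that are trivial in \<open>\<langle>S | R\<rangle>\<close>.\<close>

definition has_presentation ::
    "('a, 'b) monoid_scheme \<Rightarrow> 'a set \<Rightarrow> 'a gword set \<Rightarrow> bool" where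
  "has_presentation G S R \<longleftrightarrow>
     group G \<and> S \<subseteq> carrier G \<and> R \<subseteq> lists (S \<times> UNIV) \<and> generate G S = carrier G \<and>
     (\<forall>w \<in> lists (S \<times> UNIV). gword_eval G w = \<one>\<^bsub>G\<^esub> \<longleftrightarrow> pres_eq S R w [])"

definition coxeter_matrix :: "'a set \<Rightarrow> ('a \<Rightarrow> 'a \<Rightarrow> enat) \<Rightarrow> bool" where
  "coxeter_matrix S m \<longleftrightarrow>
     (\<forall>s\<in>S. \<forall>t\<in>S. m s t = m t s \<and> (if s = t then m s t = 1 else 2 \<le> m s t))"

definition coxeter_relators :: "'a set \<Rightarrow> ('a \<Rightarrow> 'a \<Rightarrow> enat) \<Rightarrow> 'a gword set" where
  "coxeter_relators S m =
     {concat (replicate k [(s, True), (t, True)]) | s t k. s \<in> S \<and> t \<in> S \<and> m s t = enat k}"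

definition coxeter_system :: "('a, 'b) monoid_scheme \<Rightarrow> 'a set \<Rightarrow> bool" where
  "coxeter_system W S \<longleftrightarrow>
     (\<exists>m. coxeter_matrix S m \<and> has_presentation W S (coxeter_relators S m))"

text \<open>No formal inverses are needed in the length, as the elements of \<open>S\<close> are involutions.\<close>

definition cox_length :: "('a, 'b) monoid_scheme \<Rightarrow> 'a set \<Rightarrow> 'a \<Rightarrow> nat" where
  "cox_length W S x =
     (LEAST n. \<exists>ss \<in> lists S. length ss = n \<and> foldr (\<otimes>\<^bsub>W\<^esub>) ss \<one>\<^bsub>W\<^esub> = x)"

definition cone_type :: "('a, 'b) monoid_scheme \<Rightarrow> 'a set \<Rightarrow> 'a \<Rightarrow> 'a set" where
  "cone_type W S x =
     {y \<in> carrier W. cox_length W S (x \<otimes>\<^bsub>W\<^esub> y) = cox_length W S x + cox_length W S y}"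

definition cox_suffix :: "('a, 'b) monoid_scheme \<Rightarrow> 'a set \<Rightarrow> 'a \<Rightarrow> 'a \<Rightarrow> bool" where
  "cox_suffix W S u w \<longleftrightarrow>
     cox_length W S w = cox_length W S (w \<otimes>\<^bsub>W\<^esub> inv\<^bsub>W\<^esub> u) + cox_length W S u"

definition min_cone_rep :: "('a, 'b) monoid_scheme \<Rightarrow> 'a set \<Rightarrow> 'a set \<Rightarrow> 'a \<Rightarrow> bool" where
  "min_cone_rep W S T x \<longleftrightarrow>
     is_arg_min (cox_length W S) (\<lambda>y. y \<in> carrier W \<and> cone_type W S y = T) x"

end

theory Submission
  imports Defs
begin

text \<open>
  For fixed \<open>s\<close>, the elements \<open>g\<close> with \<open>len g < len (g s)\<close> form a half-space, and so do the
  remaining ones; both are convex for paths of left multiplications. Since \<open>v s\<close> with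
  \<open>len (v s) = len v + 1\<close> lies in \<open>T(x)\<close> iff \<open>v\<close> does and \<open>x v\<close> lies in the half-space of \<open>s\<close>, the set
  \<open>X\<close> of all \<open>x\<close> with cone type \<open>T\<close> is convex, hence connected. Left descents inside \<open>X\<close> are
  locally confluent: if \<open>x\<close>, \<open>s x\<close> and \<open>t x\<close> have cone type \<open>T\<close>, where \<open>s x\<close> and \<open>t x\<close> are shorter than
  \<open>x\<close>, then \<open>x = (s t s \<dots>) y = (t s t \<dots>) y\<close> with both alternating words of equal length and both
  products reduced, and the exchange condition shows that \<open>y\<close> has cone type \<open>T\<close> as well. By Newman's
  argument every connected component of \<open>X\<close>, that is \<open>X\<close> itself, has a single locally minimal
  element, which is a suffix of all the others.

  The exchange condition comes from Tits' action of the presented group on pairs of a reflection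
  and a sign.
\<close>

declare in_listsI [rule del] in_listsD [rule del]

lemma rev_in_lists [simp]: "rev xs \<in> lists A \<longleftrightarrow> xs \<in> lists A"
  by (simp add: in_lists_conv_set)

section \<open>Words in the generators and their values in the group\<close>

locale coxeter_group = group W for W (structure) +
  fixes S
  assumes coxeter_system: "coxeter_system W S"
begin

abbreviation len :: "'a \<Rightarrow> nat" where
  "len \<equiv> cox_length W S"

abbreviation cone :: "'a \<Rightarrow> 'a set" where
  "cone \<equiv> cone_type W S"

definition wprod :: "'a list \<Rightarrow> 'a" where
  "wprod ss = foldr (\<otimes>) ss \<one>"

lemma S_closed: "s \<in> S \<Longrightarrow> s \<in> carrier W"
  using coxeter_system by (auto simp: coxeter_system_def has_presentation_def)

lemma wprod_Nil [simp]: "wprod [] = \<one>"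
  and wprod_Cons [simp]: "wprod (s # ss) = s \<otimes> wprod ss"
  by (simp_all add: wprod_def)

lemma wprod_closed [simp]: "ss \<in> lists S \<Longrightarrow> wprod ss \<in> carrier W"
  by (induction ss) (auto simp: S_closed)

lemma wprod_append:
  "us \<in> lists S \<Longrightarrow> vs \<in> lists S \<Longrightarrow> wprod (us @ vs) = wprod us \<otimes> wprod vs"
  by (induction us) (auto simp: S_closed m_assoc)

subsection \<open>The exchange condition\<close>

text \<open>The diagonal entry 1 of the Coxeter matrix makes \<open>s s\<close> itself a
  relator.\<close>

lemma S_square: "s \<otimes> s = \<one>" if "s \<in> S"
proof -
  obtain m where m: "coxeter_matrix S m" "has_presentation W S (coxeter_relators S m)"
    using coxeter_system by (auto simp: coxeter_system_def)
  have "[(s, True), (s, True)] = concat (replicate 1 [(s, True), (s, True)])"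
    by simp
  moreover have "m s s = enat 1"
    using m(1) that by (auto simp: coxeter_matrix_def one_enat_def)
  ultimately have "[(s, True), (s, True)] \<in> coxeter_relators S m"
    using that unfolding coxeter_relators_def by blast
  from pres_eq.relator[OF this, of "[]" S "[]"]
  have "pres_eq S (coxeter_relators S m) [(s, True), (s, True)] []"
    by simp
  then have "gword_eval W [(s, True), (s, True)] = \<one>"
    using m(2) that by (auto simp: has_presentation_def simp del: gword_eval.simps)
  then show ?thesis
    using S_closed[OF that] by simp
qed

lemma S_inv: "s \<in> S \<Longrightarrow> inv s = s"
  by (simp add: S_square S_closed inv_equality)

lemma S_cancel: "s \<in> S \<Longrightarrow> x \<in> carrier W \<Longrightarrow> s \<otimes> (s \<otimes> x) = x"
  by (simp add: S_square S_closed flip: m_assoc)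

lemma S_cancel_right: "s \<in> S \<Longrightarrow> x \<in> carrier W \<Longrightarrow> x \<otimes> s \<otimes> s = x"
  by (simp add: S_square S_closed m_assoc)

lemma wprod_rev: "ss \<in> lists S \<Longrightarrow> wprod (rev ss) = inv (wprod ss)"
proof (induction ss)
  case (Cons s ss)
  then have "wprod (rev (s # ss)) = inv (wprod ss) \<otimes> s"
    by (simp add: wprod_append S_closed)
  then show ?case
    using Cons by (simp add: inv_mult_group S_closed S_inv)
qed simp

text \<open>Generators are their own inverses, so positive words already exhaust the generated
  subgroup.\<close>

lemma wprod_surj:
  assumes "x \<in> carrier W"
  shows "\<exists>ss \<in> lists S. wprod ss = x"
proof -
  have "x \<in> generate W S"
    using assms coxeter_system by (auto simp: coxeter_system_def has_presentation_def)
  then show ?thesis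
  proof (induction rule: generate.induct)
    case one
    then show ?case by (auto intro: bexI[of _ "[]"])
  next
    case (incl s)
    then show ?case by (auto simp: S_closed intro!: bexI[of _ "[s]"])
  next
    case (inv s)
    then show ?case by (auto simp: S_closed S_inv intro!: bexI[of _ "[s]"])
  next
    case (eng g h)
    then obtain us vs where "us \<in> lists S" "vs \<in> lists S" "wprod us = g" "wprod vs = h"
      by blast
    then show ?case
      by (auto simp: wprod_append intro!: bexI[of _ "us @ vs"])
  qed
qed

text \<open>The second component of Tits' action of words on pairs of a group element and a sign:
  the parity of the number of \<open>j\<close> with \<open>r = s\<^sub>1 \<cdots> s\<^sub>j \<cdots> s\<^sub>1\<close>.\<close>

fun parity :: "'a list \<Rightarrow> 'a \<Rightarrow> bool" where
  "parity [] r = False"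
| "parity (s # ss) r = ((r = s) \<noteq> parity ss (s \<otimes> r \<otimes> s))"

text \<open>Cocycle rule of Tits' action: the letters of \<open>vs\<close> meet \<open>r\<close>
  conjugated by the value of \<open>us\<close>.\<close>

lemma parity_append:
  "us \<in> lists S \<Longrightarrow> r \<in> carrier W \<Longrightarrow>
    parity (us @ vs) r = (parity us r \<noteq> parity vs (inv (wprod us) \<otimes> r \<otimes> wprod us))"
proof (induction us arbitrary: r)
  case (Cons s us)
  then have "parity ((s # us) @ vs) r = ((r = s) \<noteq> (parity us (s \<otimes> r \<otimes> s) \<noteq>
      parity vs (inv (wprod us) \<otimes> (s \<otimes> r \<otimes> s) \<otimes> wprod us)))"
    by (simp add: S_closed)
  also have "inv (wprod us) \<otimes> (s \<otimes> r \<otimes> s) \<otimes> wprod us = inv (wprod (s # us)) \<otimes> r \<otimes> wprod (s # us)"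
    using Cons.prems by (simp add: inv_mult_group S_closed S_inv m_assoc)
  finally show ?case
    by auto
qed simp

text \<open>In the word \<open>s t s t ...\<close> the reflection belonging to position
  \<open>j\<close>, counted from 0, is the palindrome of length \<open>2 * j + 1\<close>, that is
  \<open>(s t)^j s\<close>.\<close>

lemma parity_dihedral:
  assumes s: "s \<in> S" and t: "t \<in> S" and r: "r \<in> carrier W"
  shows "parity (concat (replicate n [s, t])) r \<longleftrightarrow>
    odd (\<Sum>j<2 * n. of_bool (r = (s \<otimes> t) [^] j \<otimes> s) :: nat)"
  using r
proof (induction n arbitrary: r)
  case (Suc n)
  note [simp] = S_closed[OF s] S_closed[OF t] \<open>r \<in> carrier W\<close>
  have 1: "s \<otimes> r \<otimes> s = t \<longleftrightarrow> r = (s \<otimes> t) [^] Suc 0 \<otimes> s"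
  proof
    assume "s \<otimes> r \<otimes> s = t"
    then have "(s \<otimes> t) [^] Suc 0 \<otimes> s = s \<otimes> (s \<otimes> r \<otimes> s) \<otimes> s"
      by simp
    then show "r = (s \<otimes> t) [^] Suc 0 \<otimes> s"
      using s by (simp add: m_assoc S_cancel S_square)
  next
    assume "r = (s \<otimes> t) [^] Suc 0 \<otimes> s"
    then show "s \<otimes> r \<otimes> s = t"
      using s by (simp add: m_assoc S_cancel S_square)
  qed
  \<comment> \<open>Passing the first two letters shifts the exponent by two, so the induction
    hypothesis supplies the summands from index 2 on; fact \<open>1\<close> supplies the one at
    index 1.\<close>
  have 2: "t \<otimes> (s \<otimes> r \<otimes> s) \<otimes> t = (s \<otimes> t) [^] j \<otimes> s \<longleftrightarrow> r = (s \<otimes> t) [^] Suc (Suc j) \<otimes> s" for j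
  proof -
    have *: "(s \<otimes> t) [^] Suc (Suc j) = (s \<otimes> t) \<otimes> (s \<otimes> t) [^] j \<otimes> (s \<otimes> t)"
      by (metis S_closed m_closed nat_pow_Suc nat_pow_Suc2 s t)
    show ?thesis
    proof
      assume "t \<otimes> (s \<otimes> r \<otimes> s) \<otimes> t = (s \<otimes> t) [^] j \<otimes> s"
      then have "s \<otimes> (t \<otimes> (t \<otimes> (s \<otimes> r \<otimes> s) \<otimes> t) \<otimes> t) \<otimes> s = s \<otimes> (t \<otimes> ((s \<otimes> t) [^] j \<otimes> s) \<otimes> t) \<otimes> s"
        by simp
      then show "r = (s \<otimes> t) [^] Suc (Suc j) \<otimes> s"
        using s t unfolding * by (simp add: m_assoc S_cancel S_square)
    next
      assume "r = (s \<otimes> t) [^] Suc (Suc j) \<otimes> s"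
      then show "t \<otimes> (s \<otimes> r \<otimes> s) \<otimes> t = (s \<otimes> t) [^] j \<otimes> s"
        using s t unfolding * by (simp add: m_assoc S_cancel S_square)
    qed
  qed
  have "parity (concat (replicate (Suc n) [s, t])) r \<longleftrightarrow>
      (r = s) \<noteq> ((s \<otimes> r \<otimes> s = t) \<noteq>
        odd (\<Sum>j<2 * n. of_bool (t \<otimes> (s \<otimes> r \<otimes> s) \<otimes> t = (s \<otimes> t) [^] j \<otimes> s) :: nat))"
    using Suc.IH[of "t \<otimes> (s \<otimes> r \<otimes> s) \<otimes> t"] by simp
  also have "\<dots> \<longleftrightarrow> odd (\<Sum>j<2 * Suc n. of_bool (r = (s \<otimes> t) [^] j \<otimes> s) :: nat)"
    unfolding 1 2 mult_Suc_right add_2_eq_Suc sum.lessThan_Suc_shift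
    by (auto simp del: nat_pow_Suc)
  finally show ?case .
qed simp

text \<open>The reflections \<open>(s t)^j s\<close> repeat with period \<open>n\<close>, so each
  half of the \<open>2 * n\<close> positions hits \<open>r\<close> equally often.\<close>

lemma parity_relator:
  assumes "s \<in> S" "t \<in> S" "r \<in> carrier W" and one: "(s \<otimes> t) [^] n = \<one>"
  shows "\<not> parity (concat (replicate n [s, t])) r"
proof -
  let ?f = "\<lambda>j::nat. of_bool (r = (s \<otimes> t) [^] j \<otimes> s) :: nat"
  have "?f (j + n) = ?f j" for j
  proof -
    have "(s \<otimes> t) [^] (j + n) = (s \<otimes> t) [^] j"
      using assms by (simp add: S_closed flip: nat_pow_mult)
    then show ?thesis by simp
  qed
  then have "(\<Sum>j = n..<n + n. ?f j) = (\<Sum>j<n. ?f j)"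
    using sum.shift_bounds_nat_ivl[of ?f 0 n n] by (simp add: lessThan_atLeast0)
  moreover have "(\<Sum>j<2 * n. ?f j) = (\<Sum>j<n. ?f j) + (\<Sum>j = n..<n + n. ?f j)"
    using sum.atLeastLessThan_concat[of 0 n "n + n" ?f] by (simp add: lessThan_atLeast0 mult_2)
  ultimately have "even (\<Sum>j<2 * n. ?f j)"
    by simp
  then show ?thesis
    using parity_dihedral assms by simp
qed

lemma gword_eval_eq: "w \<in> lists (S \<times> UNIV) \<Longrightarrow> gword_eval W w = wprod (map fst w)"
  by (induction w) (auto simp: S_inv)

lemma wprod_alternating:
  assumes "s \<in> S" "t \<in> S"
  shows "wprod (concat (replicate n [s, t])) = (s \<otimes> t) [^] n"
proof (induction n)
  case (Suc n)
  have "wprod (concat (replicate (Suc n) [s, t])) = (s \<otimes> t) \<otimes> (s \<otimes> t) [^] n"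
    using assms Suc by (simp add: S_closed m_assoc)
  then show ?case
    using nat_pow_Suc2[of "s \<otimes> t" n] assms by (simp add: S_closed)
qed simp

lemma map_fst_lists: "w \<in> lists (S \<times> UNIV) \<Longrightarrow> map fst w \<in> lists S"
  by (auto simp: in_lists_conv_set)

text \<open>The moves of the presentation, free cancellation and deletion of relators, preserve the
  parity, and they link every word of value \<open>\<one>\<close> to the empty word.\<close>

lemma parity_trivial:
  assumes ss: "ss \<in> lists S" "wprod ss = \<one>" and r: "r \<in> carrier W"
  shows "\<not> parity ss r"
proof -
  obtain m where m: "has_presentation W S (coxeter_relators S m)"
    using coxeter_system by (auto simp: coxeter_system_def)
  define R where "R = coxeter_relators S m"
  have R_lists: "w \<in> lists (S \<times> UNIV)" if "w \<in> R" for w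
    using m that by (auto simp: has_presentation_def R_def)
  have pres: "gword_eval W w = \<one> \<longleftrightarrow> pres_eq S R w []" if "w \<in> lists (S \<times> UNIV)" for w
    using m that by (auto simp: has_presentation_def R_def)
  have delete: "parity (map fst (u @ w @ v)) r = parity (map fst (u @ v)) r"
    if u: "u \<in> lists (S \<times> UNIV)" and w: "w \<in> lists (S \<times> UNIV)" and r: "r \<in> carrier W"
      and w_one: "wprod (map fst w) = \<one>"
      and w_par: "\<And>q. q \<in> carrier W \<Longrightarrow> \<not> parity (map fst w) q" for u v w r
  proof -
    note lists = map_fst_lists[OF u] map_fst_lists[OF w]
    let ?q = "inv (wprod (map fst u)) \<otimes> r \<otimes> wprod (map fst u)"
    have q: "?q \<in> carrier W"
      using lists r by simp
    have "parity (map fst w @ map fst v) ?q = parity (map fst v) ?q"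
      using parity_append[OF lists(2) q] w_one w_par[OF q] q by simp
    then show ?thesis
      unfolding map_append parity_append[OF lists(1) r] by simp
  qed
  have "parity (map fst v) r = parity (map fst w) r" if "pres_eq S R v w" "r \<in> carrier W" for v w r
    using that
  proof (induction rule: pres_eq.induct)
    case (cancel s u v e)
    show ?case
    proof (rule delete)
      fix q assume "q \<in> carrier W"
      \<comment> \<open>Without signs the cancelled pair reads \<open>s s\<close>, and both letters
        test the same condition \<open>q = s\<close>.\<close>
      then have "s \<otimes> q \<otimes> s = s \<longleftrightarrow> q = s"
        using \<open>s \<in> S\<close> by (metis S_cancel S_cancel_right S_closed l_one S_square m_closed)
      then show "\<not> parity (map fst [(s, e), (s, \<not> e)]) q"
        by auto
    qed (use cancel in \<open>auto simp: S_closed S_square\<close>)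
  next
    case (relator w u v)
    then obtain s t k where w: "s \<in> S" "t \<in> S" "w = concat (replicate k [(s, True), (t, True)])"
      unfolding R_def coxeter_relators_def by blast
    then have fst_w: "map fst w = concat (replicate k [s, t])"
      by (simp add: map_concat)
    have "pres_eq S R w []"
      using pres_eq.relator[OF relator(1), of "[]" S "[]"] by simp
    then have "wprod (map fst w) = \<one>"
      using pres[OF R_lists[OF relator(1)]] gword_eval_eq[OF R_lists[OF relator(1)]] by simp
    moreover from this have "(s \<otimes> t) [^] k = \<one>"
      using wprod_alternating[OF w(1,2), of k] by (simp add: fst_w)
    ultimately show ?case
      using relator R_lists w(1,2) parity_relator[OF w(1,2)] fst_w
      by (intro delete) auto
  qed auto
  note * = this
  let ?w = "map (\<lambda>s. (s, True)) ss"
  have w: "?w \<in> lists (S \<times> UNIV)"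
    using ss(1) by (auto simp: in_lists_conv_set)
  have fst_w: "map fst ?w = ss"
    by (simp add: comp_def)
  have "pres_eq S R ?w []"
    using pres[OF w] gword_eval_eq[OF w] ss(2) fst_w by simp
  from *[OF this r] show ?thesis
    unfolding fst_w by simp
qed

text \<open>Appending \<open>rev vs\<close> to either word gives value \<open>\<one>\<close>, hence
  even parity, and the tail contributes equally because both words conjugate \<open>r\<close> alike.
  So the parity is a function on the group.\<close>

lemma parity_cong:
  assumes "us \<in> lists S" "vs \<in> lists S" "wprod us = wprod vs" "r \<in> carrier W"
  shows "parity us r = parity vs r"
proof -
  have rev: "rev vs \<in> lists S"
    using assms by auto
  have one: "wprod (us @ rev vs) = \<one>" "wprod (vs @ rev vs) = \<one>"
    using assms rev by (simp_all add: wprod_append wprod_rev)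
  have "\<not> parity (us @ rev vs) r" "\<not> parity (vs @ rev vs) r"
    using parity_trivial[OF _ one(1)] parity_trivial[OF _ one(2)] assms by auto
  then show ?thesis
    using parity_append[of us r "rev vs"] parity_append[of vs r "rev vs"] assms by auto
qed

text \<open>Odd parity makes \<open>r\<close> the reflection belonging to some position of
  \<open>ss\<close>; multiplying by it from the left deletes the letter there.\<close>

lemma parity_imp_deletion:
  assumes "ss \<in> lists S" "r \<in> carrier W" "parity ss r"
  shows "\<exists>us t vs. ss = us @ t # vs \<and> r \<otimes> wprod ss = wprod (us @ vs)"
  using assms
proof (induction ss arbitrary: r)
  case (Cons s ss)
  have s: "s \<in> S" and ss: "ss \<in> lists S"
    using Cons.hyps by simp_all
  show ?case
  proof (cases "r = s")
    case True
    then have "r \<otimes> wprod (s # ss) = wprod ([] @ ss)"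
      using s ss by (simp add: S_cancel)
    then show ?thesis by blast
  next
    case False
    then obtain us t vs where *: "ss = us @ t # vs" "s \<otimes> r \<otimes> s \<otimes> wprod ss = wprod (us @ vs)"
      using Cons.IH[of "s \<otimes> r \<otimes> s"] Cons.prems s ss by (auto simp: S_closed)
    have "wprod ((s # us) @ vs) = s \<otimes> (s \<otimes> r \<otimes> s \<otimes> wprod ss)"
      using * by simp
    also have "\<dots> = r \<otimes> wprod (s # ss)"
      using s ss Cons.prems by (simp add: m_assoc S_closed S_cancel)
    finally show ?thesis
      using *(1) by (metis append_Cons)
  qed
qed simp

section \<open>The length function and the exchange condition\<close>

lemma len_le: "ss \<in> lists S \<Longrightarrow> len (wprod ss) \<le> length ss"
  unfolding cox_length_def wprod_def by (rule Least_le) blast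

lemma reduced_word:
  assumes "x \<in> carrier W"
  obtains ss where "ss \<in> lists S" "length ss = len x" "wprod ss = x"
proof -
  have "\<exists>n. \<exists>ss \<in> lists S. length ss = n \<and> foldr (\<otimes>) ss \<one> = x"
    using wprod_surj[OF assms] by (auto simp: wprod_def)
  from LeastI_ex[OF this] show ?thesis
    using that unfolding cox_length_def wprod_def by blast
qed

lemma len_mult:
  assumes "x \<in> carrier W" "y \<in> carrier W"
  shows "len (x \<otimes> y) \<le> len x + len y"
proof -
  obtain us where us: "us \<in> lists S" "length us = len x" "wprod us = x"
    using reduced_word assms by blast
  obtain vs where vs: "vs \<in> lists S" "length vs = len y" "wprod vs = y"
    using reduced_word assms by blast
  show ?thesis
    using len_le[of "us @ vs"] us vs by (simp add: wprod_append)
qed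

lemma len_inv: "x \<in> carrier W \<Longrightarrow> len (inv x) = len x"
proof -
  have *: "len (inv x) \<le> len x" if x: "x \<in> carrier W" for x
  proof -
    obtain us where us: "us \<in> lists S" "length us = len x" "wprod us = x"
      by (rule reduced_word[OF x])
    then show ?thesis
      using len_le[of "rev us"] by (auto simp: wprod_rev)
  qed
  assume "x \<in> carrier W"
  with *[of x] *[of "inv x"] show ?thesis
    by simp
qed

lemma len_one [simp]: "len \<one> = 0"
  using len_le[of "[]"] by simp

lemma len_eq_0: "x \<in> carrier W \<Longrightarrow> len x = 0 \<Longrightarrow> x = \<one>"
  by (metis reduced_word length_0_conv wprod_Nil)

lemma len_S_le: "s \<in> S \<Longrightarrow> len s \<le> 1"
  using len_le[of "[s]"] by (simp add: S_closed)

text \<open>If \<open>ss\<close> is odd at \<open>s\<close>, a letter can be deleted. Otherwise let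
  \<open>ts\<close> be a reduced word of \<open>s\<close> times the element: \<open>s # ts\<close>
  has the same value as \<open>ss\<close>, so it is even at \<open>s\<close> and \<open>ts\<close>
  is odd. Deleting a letter from \<open>ts\<close> then makes the element shorter than its product
  with \<open>s\<close>, against \<open>le\<close>.\<close>

lemma exchange_left:
  assumes s: "s \<in> S" and ss: "ss \<in> lists S" "length ss = len (wprod ss)"
    and le: "len (s \<otimes> wprod ss) \<le> len (wprod ss)"
  shows "\<exists>us t vs. ss = us @ t # vs \<and> s \<otimes> wprod ss = wprod (us @ vs)"
proof (cases "parity ss s")
  case True
  then show ?thesis
    using parity_imp_deletion s ss S_closed by blast
next
  case False
  obtain ts where ts: "ts \<in> lists S" "length ts = len (s \<otimes> wprod ss)" "wprod ts = s \<otimes> wprod ss"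
    using reduced_word s ss by (metis S_closed m_closed wprod_closed)
  then have ss_eq: "s \<otimes> wprod ts = wprod ss"
    using s ss by (simp add: S_cancel)
  then have "parity (s # ts) s = parity ss s"
    using s ss ts by (intro parity_cong) (auto simp: S_closed)
  then have "parity ts s"
    using False s by (simp add: S_square S_closed)
  then obtain us t vs where us: "ts = us @ t # vs" "s \<otimes> wprod ts = wprod (us @ vs)"
    using parity_imp_deletion s ts S_closed by blast
  then have "len (wprod ss) < length ts"
    using len_le[of "us @ vs"] ts(1) ss_eq by auto
  then show ?thesis
    using ts(2) le by simp
qed

text \<open>Exchange also covers a hypothetical equality of lengths, but its result is a word one
  letter too short.\<close>

lemma len_left_neq:
  assumes s: "s \<in> S" and x: "x \<in> carrier W"
  shows "len (s \<otimes> x) \<noteq> len x"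
proof
  assume eq: "len (s \<otimes> x) = len x"
  obtain ss where ss: "ss \<in> lists S" "length ss = len x" "wprod ss = x"
    using reduced_word x by blast
  with exchange_left[OF s, of ss] eq
  obtain us t vs where "ss = us @ t # vs" "s \<otimes> x = wprod (us @ vs)"
    by auto
  then show False
    using len_le[of "us @ vs"] ss eq by auto
qed

text \<open>Inversion reverses words and preserves length, so this is the mirror image of
  \<open>exchange_left\<close>.\<close>

lemma exchange_right:
  assumes s: "s \<in> S" and ss: "ss \<in> lists S" "length ss = len (wprod ss)"
    and le: "len (wprod ss \<otimes> s) \<le> len (wprod ss)"
  shows "\<exists>us t vs. ss = us @ t # vs \<and> wprod ss \<otimes> s = wprod (us @ vs)"
proof -
  have rev: "rev ss \<in> lists S" "length (rev ss) = len (wprod (rev ss))"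
    using ss by (auto simp: wprod_rev len_inv)
  have eq: "s \<otimes> wprod (rev ss) = inv (wprod ss \<otimes> s)"
    using s ss by (simp add: wprod_rev inv_mult_group S_inv S_closed)
  have "len (s \<otimes> wprod (rev ss)) \<le> len (wprod (rev ss))"
    unfolding eq using s ss le by (simp add: wprod_rev len_inv S_closed)
  from exchange_left[OF s rev this]
  obtain us t vs where us: "rev ss = us @ t # vs" "inv (wprod ss \<otimes> s) = wprod (us @ vs)"
    unfolding eq by blast
  have ss_eq: "ss = rev vs @ t # rev us"
    using arg_cong[OF us(1), of rev] by simp
  have "us @ vs \<in> lists S"
    using rev(1) us(1) by auto
  then have "wprod (rev vs @ rev us) = wprod ss \<otimes> s"
    using wprod_rev[of "us @ vs"] us(2)[symmetric] s ss by (simp add: S_closed)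
  with ss_eq show ?thesis
    by metis
qed

lemma len_left_cases:
  assumes "s \<in> S" "x \<in> carrier W"
  shows "len (s \<otimes> x) = len x + 1 \<or> len x = len (s \<otimes> x) + 1"
  using len_left_neq[OF assms] len_S_le[OF assms(1)] len_mult[of s x] len_mult[of s "s \<otimes> x"] assms
  by (auto simp: S_closed S_cancel)

lemma len_right_cases:
  assumes "s \<in> S" "x \<in> carrier W"
  shows "len (x \<otimes> s) = len x + 1 \<or> len x = len (x \<otimes> s) + 1"
  using len_left_cases[of s "inv x"] len_inv[of "x \<otimes> s"] assms
  by (simp add: S_closed S_inv inv_mult_group len_inv)

subsection \<open>Suffixes and cone types\<close>

abbreviation suffix_of :: "'a \<Rightarrow> 'a \<Rightarrow> bool" where
  "suffix_of \<equiv> cox_suffix W S"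

lemma suffix_ofI:
  assumes "z \<in> carrier W" "u \<in> carrier W" "len (z \<otimes> u) = len z + len u"
  shows "suffix_of u (z \<otimes> u)"
  using assms by (simp add: cox_suffix_def m_assoc)

lemma suffix_ofE:
  assumes "suffix_of u w" "u \<in> carrier W" "w \<in> carrier W"
  obtains z where "z \<in> carrier W" "w = z \<otimes> u" "len w = len z + len u"
proof
  show "w = w \<otimes> inv u \<otimes> u" "w \<otimes> inv u \<in> carrier W"
    using assms by (simp_all add: m_assoc)
  show "len w = len (w \<otimes> inv u) + len u"
    using assms by (simp add: cox_suffix_def)
qed

lemma suffix_of_refl: "x \<in> carrier W \<Longrightarrow> suffix_of x x"
  by (simp add: cox_suffix_def)

lemma suffix_of_trans:
  assumes uv: "suffix_of u v" and vw: "suffix_of v w"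
    and closed: "u \<in> carrier W" "v \<in> carrier W" "w \<in> carrier W"
  shows "suffix_of u w"
proof -
  obtain a where a: "a \<in> carrier W" "v = a \<otimes> u" "len v = len a + len u"
    using suffix_ofE uv closed by blast
  obtain b where b: "b \<in> carrier W" "w = b \<otimes> v" "len w = len b + len v"
    using suffix_ofE vw closed by blast
  have w: "w = b \<otimes> a \<otimes> u"
    using a b closed by (simp add: m_assoc)
  have "len w \<le> len (b \<otimes> a) + len u" "len (b \<otimes> a) \<le> len b + len a"
    using len_mult[of "b \<otimes> a" u] len_mult[of b a] a b closed by (simp_all add: w)
  then have "len (b \<otimes> a \<otimes> u) = len (b \<otimes> a) + len u"
    using a b w by simp
  then show ?thesis
    unfolding w using a b closed by (intro suffix_ofI) auto
qed

lemma suffix_of_descent: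
  assumes "s \<in> S" "x \<in> carrier W" "len (s \<otimes> x) < len x"
  shows "suffix_of (s \<otimes> x) x"
proof -
  have "len x = len s + len (s \<otimes> x)"
    using len_left_cases[of s x] len_mult[of s "s \<otimes> x"] len_S_le[of s] assms
    by (simp add: S_cancel S_closed)
  then show ?thesis
    using suffix_ofI[of s "s \<otimes> x"] assms by (simp add: S_cancel S_closed)
qed

text \<open>Write \<open>w = z u\<close> with lengths adding; the first letter of a reduced word of
  \<open>z\<close> serves as \<open>s\<close>.\<close>

lemma proper_suffix_descent:
  assumes uw: "suffix_of u w" and closed: "u \<in> carrier W" "w \<in> carrier W" and neq: "u \<noteq> w"
  obtains s where "s \<in> S" "len (s \<otimes> w) < len w" "suffix_of u (s \<otimes> w)"
proof -
  obtain z where z: "z \<in> carrier W" "w = z \<otimes> u" "len w = len z + len u"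
    using suffix_ofE uw closed by blast
  obtain zs where zs: "zs \<in> lists S" "length zs = len z" "wprod zs = z"
    using reduced_word z by blast
  have "zs \<noteq> []"
    using zs z neq closed by auto
  then obtain s ts where "zs = s # ts"
    by (cases zs) auto
  with zs have s: "s \<in> S" and ts: "ts \<in> lists S" "Suc (length ts) = len z" "s \<otimes> wprod ts = z"
    by auto
  have sw: "s \<otimes> w = wprod ts \<otimes> u"
    unfolding z(2) ts(3)[symmetric] using s ts(1) closed by (simp add: m_assoc S_closed S_cancel)
  have "len (s \<otimes> w) \<le> len (wprod ts) + len u"
    unfolding sw using ts closed by (simp add: len_mult)
  then have 1: "len (wprod ts) + len u = len (s \<otimes> w)" "len (s \<otimes> w) < len w"
    using len_left_cases[OF s closed(2)] z(3) ts len_le[of ts] by auto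
  then show thesis
    using that[OF s] suffix_ofI[of "wprod ts" u] ts closed by (simp add: sw)
qed

lemma in_cone:
  "v \<in> carrier W \<Longrightarrow> v \<in> cone x \<longleftrightarrow> len (x \<otimes> v) = len x + len v"
  by (simp add: cone_type_def)

text \<open>If the lengths add up in \<open>z u v\<close>, subadditivity forces them to add up in
  \<open>u v\<close>.\<close>

lemma cone_antimono:
  assumes ux: "suffix_of u x" and closed: "u \<in> carrier W" "x \<in> carrier W"
  shows "cone x \<subseteq> cone u"
proof
  fix v assume "v \<in> cone x"
  then have v: "v \<in> carrier W" "len (x \<otimes> v) = len x + len v"
    by (auto simp: cone_type_def)
  obtain z where z: "z \<in> carrier W" "x = z \<otimes> u" "len x = len z + len u"
    using suffix_ofE ux closed by blast
  have "len (x \<otimes> v) \<le> len z + len (u \<otimes> v)" "len (u \<otimes> v) \<le> len u + len v"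
    using len_mult[of z "u \<otimes> v"] len_mult[of u v] closed z v by (simp_all add: m_assoc)
  then show "v \<in> cone u"
    using v z by (simp add: in_cone)
qed

text \<open>Induction along reduced words, growing at the right end; it matches
  \<open>cone_snoc\<close>.\<close>

lemma carrier_induct [consumes 1, case_names one step]:
  assumes x: "x \<in> carrier W" and one: "P \<one>"
    and step: "\<And>v s. v \<in> carrier W \<Longrightarrow> s \<in> S \<Longrightarrow> len (v \<otimes> s) = len v + 1 \<Longrightarrow> P v \<Longrightarrow> P (v \<otimes> s)"
  shows "P x"
  using x
proof (induction "len x" arbitrary: x)
  case 0
  then show ?case
    using len_eq_0 one by metis
next
  case (Suc n)
  obtain ss where ss: "ss \<in> lists S" "length ss = len x" "wprod ss = x"
    using reduced_word Suc.prems by blast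
  with Suc.hyps(2) obtain us s where "ss = us @ [s]"
    by (cases ss rule: rev_cases) auto
  with ss Suc.hyps(2) have s: "s \<in> S" and us: "us \<in> lists S" "length us = n" and x: "x = wprod us \<otimes> s"
    by (auto simp: wprod_append S_closed)
  have len: "len (wprod us) = n"
    using len_le[of us] us len_right_cases[of s "wprod us"] s Suc.hyps(2) x by auto
  show ?case
    unfolding x using Suc.hyps us s len x by (intro step) auto
qed

text \<open>Lengths add up in \<open>x v s\<close> only if each of the two steps gains its maximum.
  Cone membership thereby becomes a sequence of half-space conditions, one per letter.\<close>

lemma cone_snoc:
  assumes "x \<in> carrier W" "v \<in> carrier W" "s \<in> S" "len (v \<otimes> s) = len v + 1"
  shows "v \<otimes> s \<in> cone x \<longleftrightarrow> v \<in> cone x \<and> len (x \<otimes> v) < len (x \<otimes> v \<otimes> s)"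
proof -
  have s: "s \<in> carrier W"
    using assms by (simp add: S_closed)
  have "v \<otimes> s \<in> cone x \<longleftrightarrow> len (x \<otimes> v \<otimes> s) = len x + len v + 1"
    using assms s by (simp add: in_cone m_assoc)
  moreover have "v \<in> cone x \<longleftrightarrow> len (x \<otimes> v) = len x + len v"
    using assms by (simp add: in_cone)
  ultimately show ?thesis
    using len_right_cases[OF assms(3) m_closed[OF assms(1,2)]] len_mult[OF assms(1,2)] by linarith
qed

lemma one_in_cone: "x \<in> carrier W \<Longrightarrow> \<one> \<in> cone x"
  by (simp add: in_cone)

subsection \<open>Convexity of the set of elements with a given cone type\<close>

text \<open>The only edge at \<open>g\<close> labelled \<open>i\<close> that crosses a wall of
  \<open>s\<close> is the one that right multiplication by \<open>s\<close> flips. By exchange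
  \<open>s\<close> deletes a letter of the word of \<open>i g\<close>, and this letter can only be
  the leading \<open>i\<close>.\<close>

lemma crossing_half_space:
  assumes g: "g \<in> carrier W" and i: "i \<in> S" and s: "s \<in> S"
    and cross: "len (i \<otimes> g) < len (i \<otimes> g \<otimes> s) \<longleftrightarrow> \<not> len g < len (g \<otimes> s)"
  shows "i \<otimes> g = g \<otimes> s"
proof -
  have *: "i \<otimes> g = g \<otimes> s"
    if g: "g \<in> carrier W" and up: "len g < len (g \<otimes> s)" and down: "\<not> len (i \<otimes> g) < len (i \<otimes> g \<otimes> s)" for g
  proof -
    have [simp]: "i \<in> carrier W" "s \<in> carrier W"
      using i s by (simp_all add: S_closed)
    obtain ss where ss: "ss \<in> lists S" "length ss = len g" "wprod ss = g"
      using reduced_word g by blast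
    \<comment> \<open>Otherwise \<open>i g s\<close> would have length \<open>len g - 2\<close>,
      three less than \<open>g s\<close>, although one left multiplication separates them.\<close>
    have "len (i \<otimes> g) = len g + 1"
      using len_left_cases[OF i g] len_right_cases[OF s, of "i \<otimes> g"] up down g
        len_left_cases[OF i, of "g \<otimes> s"] by (auto simp: m_assoc)
    then obtain us t vs where us: "i # ss = us @ t # vs" "i \<otimes> g \<otimes> s = wprod (us @ vs)"
      using exchange_right[OF s, of "i # ss"] ss i down by auto
    show ?thesis
    proof (cases us)
      case Nil
      then have "i \<otimes> g \<otimes> s = g"
        using us ss by simp
      then show ?thesis
        using S_cancel_right[OF s, of "i \<otimes> g"] g by simp
    next
      \<comment> \<open>The deleted letter lies in the word of \<open>g\<close>; cancelling
        \<open>i\<close> makes \<open>g s\<close> shorter than \<open>g\<close>, against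
        \<open>up\<close>.\<close>
      case (Cons j us')
      then have ss': "ss = us' @ t # vs" "us' @ vs \<in> lists S"
        using us ss by auto
      have "i \<otimes> (g \<otimes> s) = i \<otimes> wprod (us' @ vs)"
        using us Cons g i s by (simp add: m_assoc S_closed)
      then have "g \<otimes> s = wprod (us' @ vs)"
        using g ss'(2) by (simp del: append_in_lists_conv)
      then show ?thesis
        using len_le[OF ss'(2)] up ss ss'(1) by simp
    qed
  qed
  show ?thesis
  proof (cases "len g < len (g \<otimes> s)")
    case True
    then show ?thesis using * g cross by blast
  next
    \<comment> \<open>The edge is traversed backwards, so \<open>i g\<close> takes the role of
      \<open>g\<close>.\<close>
    case False
    then have "g = i \<otimes> g \<otimes> s"
      using *[of "i \<otimes> g"] g i cross by (simp add: S_closed S_cancel)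
    then have "g \<otimes> s = i \<otimes> g \<otimes> s \<otimes> s"
      by simp
    then show ?thesis
      using g i s by (simp add: S_closed S_cancel_right)
  qed
qed

text \<open>Some letter of the path crosses the wall; by \<open>crossing_half_space\<close> it can
  be traded for a factor \<open>s\<close> on the right.\<close>

lemma crossing_word:
  assumes g: "g \<in> carrier W" and s: "s \<in> S" and ws: "ws \<in> lists S"
    and cross: "len (wprod ws \<otimes> g) < len (wprod ws \<otimes> g \<otimes> s) \<longleftrightarrow> \<not> len g < len (g \<otimes> s)"
  shows "\<exists>us i vs. ws = us @ i # vs \<and> wprod ws \<otimes> g = wprod (us @ vs) \<otimes> g \<otimes> s"
  using ws cross
proof (induction ws)
  case Nil
  then show ?case using g by simp
next
  case (Cons i ws)
  then have i: "i \<in> S" and ws: "ws \<in> lists S"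
    by auto
  have eq: "wprod (i # ws) \<otimes> g = i \<otimes> (wprod ws \<otimes> g)"
    using i ws g by (simp add: S_closed m_assoc)
  show ?case
  proof (cases "len (wprod ws \<otimes> g) < len (wprod ws \<otimes> g \<otimes> s) \<longleftrightarrow> len g < len (g \<otimes> s)")
    case True
    then have "i \<otimes> (wprod ws \<otimes> g) = wprod ws \<otimes> g \<otimes> s"
      using Cons.prems ws g i s unfolding eq by (intro crossing_half_space) auto
    then have "i # ws = [] @ i # ws \<and> wprod (i # ws) \<otimes> g = wprod ([] @ ws) \<otimes> g \<otimes> s"
      using eq by simp
    then show ?thesis by blast
  next
    case False
    then obtain us j vs where us: "ws = us @ j # vs" "wprod ws \<otimes> g = wprod (us @ vs) \<otimes> g \<otimes> s"
      using Cons.IH ws by blast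
    then have "i # ws = (i # us) @ j # vs"
      and "wprod (i # ws) \<otimes> g = wprod ((i # us) @ vs) \<otimes> g \<otimes> s"
      unfolding eq using i ws g s by (auto simp: m_assoc S_closed wprod_append)
    then show ?thesis by blast
  qed
qed

text \<open>A path crossing the wall of \<open>{g. len g < len (g \<otimes> s)}\<close> twice is shortened by reflecting the
  part between the crossings, hence is no geodesic.\<close>

lemma half_space_convex:
  assumes g: "g \<in> carrier W" and s: "s \<in> S" and vs: "vs \<in> lists S" and ws: "ws \<in> lists S"
    and geodesic: "len (wprod (vs @ ws)) = length (vs @ ws)"
    and same: "len (wprod (vs @ ws) \<otimes> g) < len (wprod (vs @ ws) \<otimes> g \<otimes> s) \<longleftrightarrow> len g < len (g \<otimes> s)"
  shows "len (wprod ws \<otimes> g) < len (wprod ws \<otimes> g \<otimes> s) \<longleftrightarrow> len g < len (g \<otimes> s)"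
proof (rule ccontr)
  let ?h = "wprod ws \<otimes> g"
  assume neq: "\<not> ?thesis"
  have h: "?h \<in> carrier W"
    using ws g by simp
  have eq: "wprod (vs @ ws) \<otimes> g = wprod vs \<otimes> ?h"
    using vs ws g by (simp add: wprod_append m_assoc)
  obtain us i us' where us: "ws = us @ i # us'" "?h = wprod (us @ us') \<otimes> g \<otimes> s"
    using crossing_word[OF g s ws] neq by blast
  obtain ts j ts' where ts: "vs = ts @ j # ts'" "wprod vs \<otimes> ?h = wprod (ts @ ts') \<otimes> ?h \<otimes> s"
    using crossing_word[OF h s vs] neq same unfolding eq by blast
  have lists: "us @ us' \<in> lists S" "ts @ ts' \<in> lists S"
    using us(1) ts(1) vs ws by auto
  have "wprod (vs @ ws) \<otimes> g = wprod (ts @ ts') \<otimes> (wprod (us @ us') \<otimes> g \<otimes> s) \<otimes> s"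
    using ts(2) unfolding eq us(2) .
  \<comment> \<open>Both crossings contribute a factor \<open>s\<close>; these cancel, and two
    letters have been lost.\<close>
  also have "\<dots> = wprod ((ts @ ts') @ (us @ us')) \<otimes> g"
    unfolding wprod_append[OF lists(2,1)]
    using wprod_closed[OF lists(1)] wprod_closed[OF lists(2)] g s
    by (simp add: m_assoc S_closed S_square del: append_assoc)
  finally have "wprod (vs @ ws) = wprod ((ts @ ts') @ (us @ us'))"
    using g lists vs ws by simp
  moreover have "(ts @ ts') @ (us @ us') \<in> lists S"
    using lists by auto
  ultimately have "len (wprod (vs @ ws)) \<le> length ((ts @ ts') @ (us @ us'))"
    by (metis len_le)
  then show False
    using geodesic us(1) ts(1) by simp
qed

text \<open>Grow \<open>v\<close> letter by letter. While \<open>v\<close> is in the cone, appending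
  \<open>s\<close> only asks on which side of the wall of \<open>s\<close> the translate by
  \<open>v\<close> lies, and the word leading from \<open>x\<close> to the other end also leads from
  \<open>x v\<close> to its translate. The ends agree, so \<open>half_space_convex\<close> settles
  the point between.\<close>

lemma cone_convex:
  assumes x: "x \<in> carrier W" and vs: "vs \<in> lists S" and ws: "ws \<in> lists S"
    and geodesic: "len (wprod (vs @ ws)) = length (vs @ ws)"
    and same: "cone (wprod (vs @ ws) \<otimes> x) = cone x"
  shows "cone (wprod ws \<otimes> x) = cone x"
proof -
  let ?y = "wprod (vs @ ws) \<otimes> x" and ?z = "wprod ws \<otimes> x"
  have closed: "?y \<in> carrier W" "?z \<in> carrier W" "wprod (vs @ ws) \<in> carrier W"
    using vs ws x by auto
  have "v \<in> cone ?z \<longleftrightarrow> v \<in> cone x" if "v \<in> carrier W" for v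
    using that
  proof (induction rule: carrier_induct)
    case one
    then show ?case
      using x closed by (simp add: one_in_cone)
  next
    case (step v s)
    show ?case
    proof (cases "v \<in> cone x")
      case True
      have "len (wprod (vs @ ws) \<otimes> (x \<otimes> v)) < len (wprod (vs @ ws) \<otimes> (x \<otimes> v) \<otimes> s)
          \<longleftrightarrow> len (x \<otimes> v) < len (x \<otimes> v \<otimes> s)"
        using cone_snoc[OF x step(1-3)] cone_snoc[OF closed(1) step(1-3)] True step(1) x closed(3)
        by (simp add: same m_assoc)
      then have "len (wprod ws \<otimes> (x \<otimes> v)) < len (wprod ws \<otimes> (x \<otimes> v) \<otimes> s)
          \<longleftrightarrow> len (x \<otimes> v) < len (x \<otimes> v \<otimes> s)"
        by (rule half_space_convex[OF m_closed[OF x step(1)] step(2) vs ws geodesic])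
      then show ?thesis
        using cone_snoc[OF x step(1-3)] cone_snoc[OF closed(2) step(1-3)] True step x ws
        by (simp add: m_assoc)
    next
      case False
      then show ?thesis
        using step cone_snoc x closed by blast
    qed
  qed
  then show ?thesis
    by (auto simp: cone_type_def)
qed

subsection \<open>Local confluence\<close>

primrec alt :: "'a \<Rightarrow> 'a \<Rightarrow> nat \<Rightarrow> 'a list" where
  "alt s t 0 = []"
| "alt s t (Suc n) = s # alt t s n"

lemma alt_in_lists: "s \<in> S \<Longrightarrow> t \<in> S \<Longrightarrow> alt s t n \<in> lists S"
  by (induction n arbitrary: s t) auto

lemma length_alt [simp]: "length (alt s t n) = n"
  by (induction n arbitrary: s t) auto

text \<open>Dropping the last letter keeps the word alternating with the same first letter; which
  letter \<open>p\<close> is depends on the parity of \<open>n\<close>.\<close>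

lemma alt_Suc_snoc: "\<exists>p. alt s t (Suc n) = alt s t n @ [p]"
proof (induction n arbitrary: s t)
  case (Suc n)
  then show ?case
    by (metis alt.simps(2) append_Cons)
qed simp

text \<open>Deleting an inner letter of an alternating word makes its two neighbours cancel.\<close>

lemma alt_delete_inner:
  assumes "s \<in> S" "t \<in> S" "alt s t n = us @ p # vs" "us \<noteq> []" "vs \<noteq> []"
  shows "len (wprod (us @ vs)) + 3 \<le> n"
proof -
  have "\<exists>ss \<in> lists S. wprod ss = wprod (us @ vs) \<and> length ss + 3 = n"
    using assms
  proof (induction us arbitrary: s t n)
    case (Cons a us)
    then obtain n' where n: "n = Suc n'" "a = s" "alt t s n' = us @ p # vs"
      by (cases n) auto
    show ?case
    proof (cases "us = []")
      case True
      obtain n'' where n': "n' = Suc n''" "alt s t n'' = vs"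
        using n True by (cases n') auto
      obtain k where k: "n'' = Suc k" "vs = s # alt t s k"
        using n' \<open>vs \<noteq> []\<close> by (cases n'') auto
      show ?thesis
        using True n n' k Cons.prems alt_in_lists[of t s k]
        by (auto simp: S_cancel intro!: bexI[of _ "alt t s k"])
    next
      case False
      then obtain ss where "ss \<in> lists S" "wprod ss = wprod (us @ vs)" "length ss + 3 = n'"
        using Cons.IH[OF _ _ n(3)] Cons.prems by blast
      then show ?thesis
        using n Cons.prems by (auto intro!: bexI[of _ "s # ss"])
    qed
  qed simp
  then show ?thesis
    using len_le by force
qed

text \<open>Deleting an inner letter would cost three letters, while \<open>len\<close> allows the
  loss of only one; so the first or the last letter goes.\<close>

lemma alt_deletion_cases:
  assumes st: "s \<in> S" "t \<in> S" and y: "y \<in> carrier W"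
    and alt: "alt s t k = us @ p # vs"
    and len: "k + len y \<le> len (wprod (us @ vs) \<otimes> y) + 1"
  shows "us @ vs = alt t s (k - 1) \<or> us @ vs = alt s t (k - 1)"
proof (cases "us = [] \<or> vs = []")
  case True
  moreover obtain n where n: "k = Suc n"
    using alt by (cases k) auto
  ultimately show ?thesis
    using alt alt_Suc_snoc[of s t n] by auto
next
  case False
  have "us @ vs \<in> lists S"
    using alt alt_in_lists[OF st, of k] by auto
  then have "len (wprod (us @ vs) \<otimes> y) \<le> len (wprod (us @ vs)) + len y"
    using y by (intro len_mult wprod_closed)
  then show ?thesis
    using alt_delete_inner[OF st alt] False len by auto
qed

lemma append_eq_snoc_cases:
  assumes "as @ bs = us @ p # vs"
  obtains (left) vs' where "as = us @ p # vs'" "vs = vs' @ bs"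
    | (right) us' where "bs = us' @ p # vs" "us = as @ us'"
proof -
  from assms obtain ts where "as = us @ ts \<and> ts @ bs = p # vs \<or> as @ ts = us \<and> bs = ts @ p # vs"
    by (auto simp: append_eq_append_conv2)
  then show thesis
    using left right[of "[]"] right[of ts] by (cases ts) auto
qed

text \<open>Exchange \<open>t\<close> into the reduced word \<open>alt s t k @ ys\<close>. A
  deletion in \<open>ys\<close> would give a longer alternating prefix, against
  \<open>maximal\<close>; so it happens in the prefix, at one of its ends.\<close>

lemma flip_alternating_prefix:
  assumes st: "s \<in> S" "t \<in> S" "s \<noteq> t" and x: "x \<in> carrier W" and y: "y \<in> carrier W"
    and descent: "len (t \<otimes> x) < len x"
    and x_eq: "x = wprod (alt s t k) \<otimes> y" "len x = k + len y" and k: "0 < k"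
    and maximal: "\<And>y'. y' \<in> carrier W \<Longrightarrow> x = wprod (alt t s (Suc k)) \<otimes> y' \<Longrightarrow> len x \<noteq> Suc k + len y'"
  shows "x = wprod (alt t s k) \<otimes> y"
proof -
  obtain ys where ys: "ys \<in> lists S" "length ys = len y" "wprod ys = y"
    using reduced_word y by blast
  note A = alt_in_lists[OF st(1,2), of k]
  have t: "t \<in> carrier W"
    using st S_closed by blast
  have word: "wprod (alt s t k @ ys) = x" "alt s t k @ ys \<in> lists S"
    using x_eq ys A by (auto simp: wprod_append)
  obtain us p vs where us: "alt s t k @ ys = us @ p # vs" "t \<otimes> x = wprod (us @ vs)"
    using exchange_left[OF st(2), of "alt s t k @ ys"] word ys x_eq descent by auto
  from us(1) show ?thesis
  proof (cases rule: append_eq_snoc_cases)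
    case (left vs')
    have lists: "us @ vs' \<in> lists S"
      using A left by auto
    have tx: "t \<otimes> x = wprod (us @ vs') \<otimes> y"
      using us(2) left ys lists wprod_append[OF lists ys(1)] by simp
    then have "len x \<le> len (wprod (us @ vs') \<otimes> y) + 1"
      using len_left_cases[OF st(2) x] by auto
    then have "us @ vs' = alt t s (k - 1) \<or> us @ vs' = alt s t (k - 1)"
      using alt_deletion_cases[OF st(1,2) y left(1)] x_eq by simp
    then show ?thesis
    proof
      \<comment> \<open>The first letter was deleted: putting \<open>s\<close> back yields
        \<open>s t x = x\<close>, impossible for distinct generators.\<close>
      assume "us @ vs' = alt t s (k - 1)"
      then have "s \<otimes> (t \<otimes> x) = wprod (alt s t k) \<otimes> y"
        using k st y alt_in_lists[OF st(2,1), of "k - 1"] unfolding tx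
        by (cases k) (auto simp: S_closed m_assoc)
      then have "s \<otimes> t \<otimes> x = \<one> \<otimes> x"
        using x_eq st x by (simp add: S_closed m_assoc)
      then have "s \<otimes> t = \<one>"
        using x st by (simp add: S_closed del: l_one)
      then have "s = t"
        using S_cancel_right[OF st(2), of s] st by (simp add: S_closed)
      then show ?thesis
        using st by simp
    next
      \<comment> \<open>The last letter was deleted: prepending \<open>t\<close> yields the flipped
        prefix.\<close>
      assume "us @ vs' = alt s t (k - 1)"
      then have "t \<otimes> (t \<otimes> x) = wprod (alt t s k) \<otimes> y"
        using k st y alt_in_lists[OF st(1,2), of "k - 1"] unfolding tx
        by (cases k) (auto simp: S_closed m_assoc)
      then show ?thesis
        using st x by (simp add: S_cancel)
    qed
  next
    case (right us')
    have lists: "us' @ vs \<in> lists S"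
      using ys right by auto
    have "t \<otimes> x = wprod (alt s t k) \<otimes> wprod (us' @ vs)"
      using us(2) right wprod_append[OF A lists] by simp
    then have "t \<otimes> (t \<otimes> x) = t \<otimes> (wprod (alt s t k) \<otimes> wprod (us' @ vs))"
      by simp
    then have x_eq': "x = wprod (alt t s (Suc k)) \<otimes> wprod (us' @ vs)"
      using S_cancel[OF st(2) x] wprod_closed[OF lists] A t by (simp add: m_assoc)
    have "len x \<le> Suc k + len (wprod (us' @ vs))"
      using len_mult[of "wprod (alt t s (Suc k))" "wprod (us' @ vs)"]
        len_le[OF alt_in_lists[OF st(2,1), of "Suc k"]] x_eq'
        wprod_closed[OF lists] wprod_closed[OF alt_in_lists[OF st(2,1), of "Suc k"]] by simp
    moreover have "len (wprod (us' @ vs)) < len y"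
      using len_le[OF lists] ys right by simp
    ultimately have "len x = Suc k + len (wprod (us' @ vs))"
      using x_eq by simp
    then show ?thesis
      using maximal[OF wprod_closed[OF lists] x_eq'] by blast
  qed
qed

text \<open>Take the longest alternating prefix that splits off \<open>x\<close> with lengths
  adding; the letter with which it does not start is a descent too, so the prefix can be
  flipped.\<close>

lemma two_descents:
  assumes st: "s \<in> S" "t \<in> S" "s \<noteq> t" and x: "x \<in> carrier W"
    and descent: "len (s \<otimes> x) < len x" "len (t \<otimes> x) < len x"
  obtains k y where "y \<in> carrier W" "0 < k" "len x = k + len y"
    "x = wprod (alt s t k) \<otimes> y" "x = wprod (alt t s k) \<otimes> y"
proof -
  \<comment> \<open>\<open>P\<close> allows both orders of \<open>s\<close> and \<open>t\<close>, so
    that maximality of \<open>k\<close> excludes longer prefixes with either first letter.\<close>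
  define P where "P k \<longleftrightarrow> (\<exists>p q y. {p, q} = {s, t} \<and> y \<in> carrier W \<and>
    x = wprod (alt p q k) \<otimes> y \<and> len x = k + len y)" for k
  have bound: "k \<le> len x" if "P k" for k
    using that by (auto simp: P_def)
  have "x = wprod (alt s t 1) \<otimes> (s \<otimes> x)"
    using st x by (simp add: S_cancel S_closed)
  moreover have "len x = 1 + len (s \<otimes> x)"
    using len_left_cases[of s x] st x descent by auto
  ultimately have "P 1"
    unfolding P_def using S_closed st x by blast
  define k where "k = Greatest P"
  have "P k"
    unfolding k_def using \<open>P 1\<close> bound by (rule GreatestI_nat)
  have k: "0 < k"
    using Greatest_le_nat[of P, OF \<open>P 1\<close> bound] by (simp add: k_def)
  have "\<not> P (Suc k)"
    using Greatest_le_nat[of P "Suc k" "len x"] bound by (auto simp: k_def)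
  from \<open>P k\<close> obtain p q y where pq: "{p, q} = {s, t}" and y: "y \<in> carrier W"
    and x_eq: "x = wprod (alt p q k) \<otimes> y" "len x = k + len y"
    unfolding P_def by blast
  have pq': "p \<in> S" "q \<in> S" "p \<noteq> q" "len (q \<otimes> x) < len x"
    using pq st descent by (auto simp: doubleton_eq_iff)
  have "x = wprod (alt q p k) \<otimes> y"
  proof (rule flip_alternating_prefix[OF pq'(1-3) x y pq'(4) x_eq k])
    fix y' assume "y' \<in> carrier W" "x = wprod (alt q p (Suc k)) \<otimes> y'"
    moreover have "{q, p} = {s, t}"
      using pq by auto
    ultimately show "len x \<noteq> Suc k + len y'"
      using \<open>\<not> P (Suc k)\<close> unfolding P_def by blast
  qed
  with x_eq pq y k show thesis
    using that by (auto simp: doubleton_eq_iff)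
qed

text \<open>The word without its first letter bounds the length of \<open>s x\<close> from above; as
  \<open>s\<close> changes length by exactly one, lengths still add.\<close>

lemma suffix_of_alt:
  assumes st: "s \<in> S" "t \<in> S" and x: "x \<in> carrier W" and y: "y \<in> carrier W"
    and x_eq: "x = wprod (alt s t k) \<otimes> y" "len x = k + len y" and k: "0 < k"
  shows "s \<otimes> x = wprod (alt t s (k - 1)) \<otimes> y" "len (s \<otimes> x) < len x" "suffix_of y (s \<otimes> x)"
proof -
  obtain n where n: "k = Suc n"
    using k by (cases k) auto
  note A = alt_in_lists[OF st(2,1), of n]
  have sx: "s \<otimes> x = wprod (alt t s n) \<otimes> y"
    using x_eq(1) n A y st by (simp add: m_assoc S_closed S_cancel)
  then show "s \<otimes> x = wprod (alt t s (k - 1)) \<otimes> y"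
    by (simp add: n)
  have le: "len (s \<otimes> x) \<le> len (wprod (alt t s n)) + len y" "len (wprod (alt t s n)) \<le> n"
    using sx A y len_mult len_le[OF A] by auto
  then show less: "len (s \<otimes> x) < len x"
    using x_eq n by simp
  then have "len (s \<otimes> x) = n + len y"
    using len_left_cases[OF st(1) x] x_eq n by simp
  then show "suffix_of y (s \<otimes> x)"
    using suffix_ofI[of "wprod (alt t s n)" y] sx le A y by simp
qed

text \<open>By \<open>eq\<close>, \<open>r\<close> carries \<open>s x v\<close> back up to
  \<open>x v\<close>, which is longer because \<open>v\<close> lies in both cones. So
  \<open>v r\<close> lies in the cone of \<open>s x\<close>, which is that of
  \<open>x\<close>.\<close>

lemma cone_extend:
  assumes sx: "cone (s \<otimes> x) = cone x" "len (s \<otimes> x) < len x"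
    and closed: "s \<in> S" "x \<in> carrier W" "r \<in> S" "v \<in> cone x" "len (v \<otimes> r) = len v + 1"
    and eq: "x \<otimes> v \<otimes> r = s \<otimes> x \<otimes> v"
  shows "v \<otimes> r \<in> cone x"
proof -
  have v: "v \<in> carrier W" "len (x \<otimes> v) = len x + len v" "len (s \<otimes> x \<otimes> v) = len (s \<otimes> x) + len v"
    using closed(4) sx(1) by (auto simp: cone_type_def)
  have "s \<otimes> x \<otimes> v \<otimes> r = x \<otimes> v \<otimes> r \<otimes> r"
    using eq by simp
  then have "s \<otimes> x \<otimes> v \<otimes> r = x \<otimes> v"
    using closed v by (simp add: S_cancel_right)
  then have "len (s \<otimes> x \<otimes> v) < len (s \<otimes> x \<otimes> v \<otimes> r)"
    using v sx by simp
  then have "v \<otimes> r \<in> cone (s \<otimes> x)"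
    using cone_snoc[of "s \<otimes> x" v r] closed v sx(1) by (simp add: S_closed)
  then show ?thesis
    using sx by simp
qed

text \<open>Here \<open>y\<close> is what remains of \<open>x\<close> after its common alternating
  prefix. Only \<open>cone y \<subseteq> cone x\<close> needs work: at a first failure
  \<open>v r\<close>, the letter \<open>r\<close> shortens \<open>x v\<close>, and exchange deletes
  a letter either of the prefix or of the word of \<open>y v\<close>.\<close>

lemma cone_local_confluence:
  assumes st: "s \<in> S" "t \<in> S" "s \<noteq> t" and x: "x \<in> carrier W"
    and descent: "len (s \<otimes> x) < len x" "len (t \<otimes> x) < len x"
    and cone: "cone (s \<otimes> x) = cone x" "cone (t \<otimes> x) = cone x"
  obtains y where "y \<in> carrier W" "cone y = cone x" "suffix_of y (s \<otimes> x)" "suffix_of y (t \<otimes> x)"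
proof -
  obtain k y where y: "y \<in> carrier W" and k: "0 < k" and len_x: "len x = k + len y"
    and x_eq: "x = wprod (alt s t k) \<otimes> y" "x = wprod (alt t s k) \<otimes> y"
    using two_descents[OF st x descent] by blast
  note sx = suffix_of_alt[OF st(1,2) x y x_eq(1) len_x k]
  note tx = suffix_of_alt[OF st(2,1) x y x_eq(2) len_x k]
  have sx_closed: "s \<otimes> x \<in> carrier W"
    using st x by (simp add: S_closed)
  have "suffix_of y x"
    using suffix_of_trans[OF sx(3) suffix_of_descent[OF st(1) x descent(1)]] sx_closed x y by blast
  then have "cone x \<subseteq> cone y"
    using cone_antimono x y by blast
  moreover have "v \<in> cone y \<longrightarrow> v \<in> cone x" if "v \<in> carrier W" for v
    using that
  proof (induction rule: carrier_induct)
    case one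
    then show ?case
      using x by (simp add: one_in_cone)
  next
    case (step v r)
    show ?case
    proof (rule impI, rule ccontr)
      assume vr: "v \<otimes> r \<in> cone y" "v \<otimes> r \<notin> cone x"
      then have v: "v \<in> cone x" "v \<in> cone y" "len (y \<otimes> v) < len (y \<otimes> v \<otimes> r)"
        and not_less: "\<not> len (x \<otimes> v) < len (x \<otimes> v \<otimes> r)"
        using cone_snoc[OF x step(1-3)] cone_snoc[OF y step(1-3)] step(4) by auto
      have yv: "y \<otimes> v \<in> carrier W" and r: "r \<in> carrier W"
        using y step by (simp_all add: S_closed)
      have len_xv: "len (x \<otimes> v) = k + len (y \<otimes> v)"
        using v step(1) len_x by (simp add: in_cone)
      obtain ws where ws: "ws \<in> lists S" "length ws = len (y \<otimes> v)" "wprod ws = y \<otimes> v"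
        using reduced_word yv by blast
      note A = alt_in_lists[OF st(1,2), of k]
      have word: "wprod (alt s t k @ ws) = x \<otimes> v" "alt s t k @ ws \<in> lists S"
        using x_eq(1) ws A y step(1) by (auto simp: wprod_append m_assoc)
      obtain us p vs where us: "alt s t k @ ws = us @ p # vs" "x \<otimes> v \<otimes> r = wprod (us @ vs)"
        using exchange_right[OF step(2), of "alt s t k @ ws"] word ws len_xv not_less by auto
      from us(1) show False
      proof (cases rule: append_eq_snoc_cases)
        case (left vs')
        have lists: "us @ vs' \<in> lists S"
          using A left by auto
        have xvr: "x \<otimes> v \<otimes> r = wprod (us @ vs') \<otimes> (y \<otimes> v)"
          using us(2) left ws wprod_append[OF lists ws(1)] by simp
        have "len (x \<otimes> v) \<le> len (x \<otimes> v \<otimes> r) + 1"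
          using len_right_cases[OF step(2), of "x \<otimes> v"] x step(1) by auto
        then have "us @ vs' = alt t s (k - 1) \<or> us @ vs' = alt s t (k - 1)"
          using alt_deletion_cases[OF st(1,2) yv left(1)] xvr len_xv by simp
        \<comment> \<open>Without its first letter the prefix turns \<open>x v\<close> into
          \<open>s x v\<close>; without its last letter it is the flipped prefix without its leading
          \<open>t\<close>, which gives \<open>t x v\<close>.\<close>
        then have "x \<otimes> v \<otimes> r = s \<otimes> x \<otimes> v \<or> x \<otimes> v \<otimes> r = t \<otimes> x \<otimes> v"
          using xvr sx(1) tx(1) y step(1) alt_in_lists[OF st(1,2), of "k - 1"]
            alt_in_lists[OF st(2,1), of "k - 1"] by (auto simp: m_assoc)
        then show False
          using cone_extend[OF cone(1) descent(1) st(1) x step(2) v(1) step(3)]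
            cone_extend[OF cone(2) descent(2) st(2) x step(2) v(1) step(3)] vr(2) by blast
      next
        \<comment> \<open>Cancelling the prefix shows that \<open>r\<close> shortens
          \<open>y v\<close>, although \<open>v r\<close> lies in the cone of
          \<open>y\<close>.\<close>
        case (right us')
        have lists: "us' @ vs \<in> lists S"
          using ws right by auto
        have "wprod (alt s t k) \<otimes> (y \<otimes> v \<otimes> r) = x \<otimes> v \<otimes> r"
          using x_eq(1) A y r step(1) by (simp add: m_assoc)
        also have "\<dots> = wprod (alt s t k) \<otimes> wprod (us' @ vs)"
          using us(2) right wprod_append[OF A lists] by simp
        finally have "y \<otimes> v \<otimes> r = wprod (us' @ vs)"
          using wprod_closed[OF A] wprod_closed[OF lists] yv r by simp
        then show False
          using len_le[OF lists] v(3) ws(2) right by simp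
      qed
    qed
  qed
  ultimately have "cone y = cone x"
    by (auto simp: cone_type_def)
  then show thesis
    using that y sx(3) tx(3) by blast
qed

subsection \<open>Unique minimal elements\<close>

text \<open>The irreducible elements for the rewriting steps from \<open>x\<close> to a shorter
  \<open>s x\<close> of the same cone type.\<close>

definition local_min :: "'a \<Rightarrow> bool" where
  "local_min m \<longleftrightarrow> m \<in> carrier W \<and> (\<forall>s \<in> S. len (s \<otimes> m) < len m \<longrightarrow> cone (s \<otimes> m) \<noteq> cone m)"

text \<open>A normal form of \<open>x\<close>; the suffix condition stands for reachability by
  rewriting steps, as \<open>base_proper\<close> shows.\<close>

definition base :: "'a \<Rightarrow> 'a \<Rightarrow> bool" where
  "base m x \<longleftrightarrow> local_min m \<and> cone m = cone x \<and> suffix_of m x"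

lemma base_closed: "base m x \<Longrightarrow> m \<in> carrier W"
  by (simp add: base_def local_min_def)

lemma base_exists: "x \<in> carrier W \<Longrightarrow> \<exists>m. base m x"
proof (induction "len x" arbitrary: x rule: less_induct)
  case less
  show ?case
  proof (cases "local_min x")
    case True
    then show ?thesis
      using less.prems by (auto simp: base_def suffix_of_refl)
  next
    case False
    then obtain s where s: "s \<in> S" "len (s \<otimes> x) < len x" "cone (s \<otimes> x) = cone x"
      using less.prems by (auto simp: local_min_def)
    then obtain m where "base m (s \<otimes> x)"
      using less S_closed by (meson m_closed)
    then have "base m x"
      using suffix_of_trans[OF _ suffix_of_descent] s less.prems
      by (auto simp: base_def local_min_def S_closed)
    then show ?thesis ..
  qed
qed

lemma base_trans:
  assumes "base m z" "suffix_of z x" "cone z = cone x" "z \<in> carrier W" "x \<in> carrier W"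
  shows "base m x"
  using assms suffix_of_trans[of m z x] base_closed[of m z] by (auto simp: base_def)

text \<open>In the suffix order \<open>s x\<close> lies between \<open>m\<close> and
  \<open>x\<close>, so its cone is squeezed between two equal cones.\<close>

lemma base_proper:
  assumes m: "base m x" and x: "x \<in> carrier W" and neq: "m \<noteq> x"
  obtains s where "s \<in> S" "len (s \<otimes> x) < len x" "cone (s \<otimes> x) = cone x" "base m (s \<otimes> x)"
proof -
  have *: "m \<in> carrier W" "cone m = cone x" "suffix_of m x"
    using m base_closed by (auto simp: base_def)
  obtain s where s: "s \<in> S" "len (s \<otimes> x) < len x" "suffix_of m (s \<otimes> x)"
    using proper_suffix_descent[OF *(3,1) x neq] by blast
  have sx: "s \<otimes> x \<in> carrier W"
    using s x by (simp add: S_closed)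
  have "cone x \<subseteq> cone (s \<otimes> x)" "cone (s \<otimes> x) \<subseteq> cone m"
    using cone_antimono suffix_of_descent s x sx * by blast+
  then show thesis
    using that s m *(2) by (simp add: base_def)
qed

text \<open>Newman's argument: by local confluence the two descents share a suffix \<open>z\<close>
  of the same cone type, and a base of \<open>z\<close> equals both \<open>m\<close> and
  \<open>m'\<close> by induction.\<close>

lemma base_unique:
  assumes "x \<in> carrier W" "base m x" "base m' x"
  shows "m = m'"
  using assms
proof (induction "len x" arbitrary: x m m' rule: less_induct)
  case less
  show ?case
  proof (cases "local_min x")
    case True
    then have "n = x" if "base n x" for n
      using base_proper[OF that less.prems(1)] by (auto simp: local_min_def)
    with less.prems show ?thesis by blast
  next
    case False
    then have "m \<noteq> x" "m' \<noteq> x"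
      using less.prems by (auto simp: base_def)
    then obtain s t
      where s: "s \<in> S" "len (s \<otimes> x) < len x" "cone (s \<otimes> x) = cone x" "base m (s \<otimes> x)"
        and t: "t \<in> S" "len (t \<otimes> x) < len x" "cone (t \<otimes> x) = cone x" "base m' (t \<otimes> x)"
      using base_proper less.prems by metis
    have closed: "s \<otimes> x \<in> carrier W" "t \<otimes> x \<in> carrier W"
      using s t less.prems by (simp_all add: S_closed)
    show ?thesis
    proof (cases "s = t")
      case True
      then show ?thesis
        using less.hyps s t closed by blast
    next
      case False
      obtain z where z: "z \<in> carrier W" "cone z = cone x" "suffix_of z (s \<otimes> x)" "suffix_of z (t \<otimes> x)"
        using cone_local_confluence[OF s(1) t(1) False less.prems(1) s(2) t(2) s(3) t(3)] by blast
      obtain n where "base n z"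
        using base_exists z by blast
      then have "base n (s \<otimes> x)" "base n (t \<otimes> x)"
        using base_trans z s t closed by auto
      then show ?thesis
        using less.hyps[OF s(2) closed(1) s(4)] less.hyps[OF t(2) closed(2) t(4)] by blast
    qed
  qed
qed

text \<open>One of \<open>x\<close> and \<open>s x\<close> is a suffix of the other. Going up, the
  base is inherited; going down, \<open>s x\<close> has some base, which is also one of
  \<open>x\<close> and hence \<open>m\<close>.\<close>

lemma base_neighbour:
  assumes x: "x \<in> carrier W" and s: "s \<in> S" and cone: "cone (s \<otimes> x) = cone x"
    and m: "base m x"
  shows "base m (s \<otimes> x)"
proof -
  have sx: "s \<otimes> x \<in> carrier W"
    using s x by (simp add: S_closed)
  show ?thesis
  proof (cases "len (s \<otimes> x) < len x")
    case True
    obtain n where n: "base n (s \<otimes> x)"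
      using base_exists sx by blast
    then have "base n x"
      using base_trans suffix_of_descent[OF s x True] cone sx x by blast
    then show ?thesis
      using base_unique m n x by blast
  next
    case False
    then have "len (s \<otimes> (s \<otimes> x)) < len (s \<otimes> x)"
      using len_left_cases[OF s x] s x by (simp add: S_cancel)
    then have "suffix_of x (s \<otimes> x)"
      using suffix_of_descent[OF s sx] s x by (simp add: S_cancel)
    then show ?thesis
      using base_trans m cone x sx by simp
  qed
qed

text \<open>Walk along a geodesic from \<open>x\<close> to \<open>y\<close>: by convexity the cone
  type stays constant, and each step keeps the base.\<close>

lemma base_same_cone:
  assumes x: "x \<in> carrier W" and y: "y \<in> carrier W" and cone: "cone y = cone x" and m: "base m x"
  shows "base m y"
proof -
  obtain us where us: "us \<in> lists S" "length us = len (y \<otimes> inv x)" "wprod us = y \<otimes> inv x"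
    using reduced_word x y by (metis inv_closed m_closed)
  then have y_eq: "y = wprod us \<otimes> x"
    using x y by (simp add: m_assoc)
  have "base m (wprod ws \<otimes> x)" if "us = vs @ ws" for vs ws
    using that
  proof (induction ws arbitrary: vs)
    case Nil
    then show ?case
      using m x by simp
  next
    case (Cons s ws)
    have lists: "vs \<in> lists S" "s # ws \<in> lists S" "vs @ [s] \<in> lists S" "ws \<in> lists S" "s \<in> S"
      using Cons.prems us(1) by auto
    have eq: "wprod (s # ws) \<otimes> x = s \<otimes> (wprod ws \<otimes> x)"
      using lists x by (simp add: m_assoc S_closed)
    have "cone (wprod (s # ws) \<otimes> x) = cone x"
      using cone_convex[OF x lists(1,2)] us Cons.prems cone y_eq by simp
    moreover have "cone (wprod ws \<otimes> x) = cone x"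
      using cone_convex[OF x lists(3,4)] us Cons.prems cone y_eq by simp
    ultimately show ?case
      using Cons.IH[of "vs @ [s]"] Cons.prems lists x base_neighbour[of "wprod ws \<otimes> x" s m]
      unfolding eq by simp
  qed
  from this[of "[]" us] show ?thesis
    using y_eq by simp
qed

text \<open>A shortest representative is locally minimal, hence its own base and then the base of
  every \<open>w\<close> of its cone type.\<close>

lemma min_cone_rep_base:
  assumes m: "min_cone_rep W S T m" and w: "w \<in> carrier W" "cone w = T"
  shows "base m w"
proof -
  have *: "m \<in> carrier W" "cone m = T"
    and min: "\<And>y. y \<in> carrier W \<Longrightarrow> cone y = T \<Longrightarrow> \<not> len y < len m"
    using m by (auto simp: min_cone_rep_def is_arg_min_def)
  then have "base m m"
    by (auto simp: base_def local_min_def suffix_of_refl S_closed)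
  then show ?thesis
    using base_same_cone[OF *(1) w(1)] * w by simp
qed

end

theorem theorem1:
  fixes W :: "('a, 'b) monoid_scheme" and S :: "'a set"
  assumes "coxeter_system W S" and "finite S"
  shows "\<forall>T \<in> cone_type W S ` carrier W.
           (\<exists>!m. min_cone_rep W S T m) \<and>
           (\<forall>m w. min_cone_rep W S T m \<and> w \<in> carrier W \<and> cone_type W S w = T
              \<longrightarrow> cox_suffix W S m w)"
proof
  interpret group W
    using assms(1) by (auto simp: coxeter_system_def has_presentation_def)
  interpret coxeter_group W S
    using assms(1) by unfold_locales
  fix T assume "T \<in> cone_type W S ` carrier W"
  then obtain x where x: "x \<in> carrier W" "cone_type W S x = T"
    by blast
  have "\<exists>m. min_cone_rep W S T m"
    using ex_has_least_nat[of "\<lambda>y. y \<in> carrier W \<and> cone_type W S y = T" x "cox_length W S"] x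
    by (auto simp: min_cone_rep_def is_arg_min_linorder)
  then have "\<exists>!m. min_cone_rep W S T m"
    using min_cone_rep_base base_unique x by blast
  moreover have "cox_suffix W S m w"
    if "min_cone_rep W S T m" "w \<in> carrier W" "cone_type W S w = T" for m w
    using min_cone_rep_base[OF that] by (simp add: base_def)
  ultimately show "(\<exists>!m. min_cone_rep W S T m) \<and>
      (\<forall>m w. min_cone_rep W S T m \<and> w \<in> carrier W \<and> cone_type W S w = T \<longrightarrow> cox_suffix W S m w)"
    by blast
qed

end
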